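(* Let $c$ be a constraint over variables with domain $[1,d]$. Then unit-propagation on the bound encoding of $c$ (with $c$ required to hold) enforces bound consistency on $c$.
   Context: Constraints. Variables have domain $[1,d]=\{1,\dots,d\}$. A constraint $c$ has a scope $\mathrm{scope}(c)=(v_1,\dots,v_n)$ of variables and a relation $\mathrm{range}(c)\subseteq[1,d]^n$ of allowed tuples. Current domains $D(v)\subseteq[1,d]$ are intervals. A bound support for $v_i=a$ is an allowed tuple with $i$-th entry $a$ and, for every $j\neq i$, $j$-th entry in $[\min D(v_j),\max D(v_j)]$. The constraint is bound consistent iff for every $v_i\in\mathrm{scope}(c)$ and each $a\in\{\min D(v_i),\max D(v_i)\}$ there is a bound support for $v_i=a$. Enforcing bound consistency means replacing the interval domains by the largest interval subdomains for which $c$ is bound consistent; failure means that some domain becomes empty. Logic programs and unit-propagation. A rule $h\leftarrow a_1,\dots,a_m,\mathit{not}\,a_{m+1},\dots,\mathit{not}\,a_k$ has head $h$ and body the set of literals on its right; $\bot$ is the always-false atom. A choice rule $\{h_1,\dots,h_k\}\leftarrow$ leaves $h_1,\dots,h_k$ free. Unit-propagation works on partial truth assignments to atoms and rule bodies, using the nogoods (forbidden sets of truth-value assignments) expressing that: a body is true iff its literals are all true; a true body makes its head true; an atom is true only if the body of some rule having it in its head is true; $\bot$ is false. Whenever all but one element of a nogood hold, the complement of the remaining element is added; a conflict occurs if all elements of some nogood hold. Bound encoding of $c$. For each $v\in\mathrm{scope}(c)$ there are atoms $b(v,i)$, $1\le i\le d$ (meaning $v\le i$), and the rules $\{b(v,1),\dots,b(v,d)\}\leftarrow$;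 $\ \bot\leftarrow b(v,i),\mathit{not}\,b(v,i+1)$ for $1\le i<d$; $\ \bot\leftarrow\mathit{not}\,b(v,d)$. In addition there are the rules $sat(c)\leftarrow\mathit{not}\,violate(c)$ and $violate(c)\leftarrow\mathit{not}\,sat(c)$, and, for every conflict region of $c$, i.e. every box $l_1<v_1\le u_1,\dots,l_n<v_n\le u_n$ (with $0\le l_j<u_j\le d$) that contains no allowed tuple, the rule $violate(c)\leftarrow b(v_1,u_1),\dots,b(v_n,u_n),\mathit{not}\,b(v_1,l_1),\dots,\mathit{not}\,b(v_n,l_n)$, where $b(v,0)$ is taken as false (so $\mathit{not}\,b(v,0)$ is omitted). Enforcing a consistency by unit-propagation. Given nonempty initial interval domains $D(v)=[p_v,q_v]\subseteq[1,d]$, start from the assignment in which $violate(c)$ is false, $b(v,p_v-1)$ is false (if $p_v>1$) and $b(v,q_v)$ is true, and run unit-propagation to fixpoint. The domain of $v$ at the fixpoint is the interval $[p,q]$ where $p-1$ is the largest $i\ge 0$ with $b(v,i)$ false and $q$ is the smallest $i$ with $b(v,i)$ true. That unit-propagation enforces bound consistency means: for all such initial domains, a conflict occurs iff enforcing bound consistency fails, and otherwise the domains at the fixpoint equal those obtained by enforcing bound consistency. *)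

theory Defs
  imports Main
begin

section \<open>Constraints and bound consistency\<close>

datatype 'v constraint = Constraint (scope: "'v list") (allowed: "nat list set")

text \<open>The variables of the scope are pairwise distinct and there is at least one of them;
  allowed tuples are lists, whose entries are numbered from 0.\<close>

definition is_constraint :: "nat \<Rightarrow> 'v constraint \<Rightarrow> bool" where
  "is_constraint d c \<longleftrightarrow>
     scope c \<noteq> [] \<and> distinct (scope c) \<and>
     (\<forall>t\<in>allowed c. length t = length (scope c) \<and> set t \<subseteq> {1..d})"

text \<open>\<^term>\<open>Min {}\<close> and \<^term>\<open>Max {}\<close> are unspecified, hence the explicit nonemptiness conditions:
  an empty domain has no bounds and contains no value.\<close>

definition bound_support :: "'v constraint \<Rightarrow> ('v \<Rightarrow> nat set) \<Rightarrow> nat \<Rightarrow> nat \<Rightarrow> nat list \<Rightarrow> bool" where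
  "bound_support c D i a t \<longleftrightarrow>
     t \<in> allowed c \<and> t ! i = a \<and>
     (\<forall>j<length (scope c). j \<noteq> i \<longrightarrow>
        D (scope c ! j) \<noteq> {} \<and>
        Min (D (scope c ! j)) \<le> t ! j \<and> t ! j \<le> Max (D (scope c ! j)))"

definition bound_consistent :: "'v constraint \<Rightarrow> ('v \<Rightarrow> nat set) \<Rightarrow> bool" where
  "bound_consistent c D \<longleftrightarrow>
     (\<forall>i<length (scope c). D (scope c ! i) \<noteq> {} \<longrightarrow>
        (\<forall>a\<in>{Min (D (scope c ! i)), Max (D (scope c ! i))}. \<exists>t. bound_support c D i a t))"

definition bc_subdomains :: "'v constraint \<Rightarrow> ('v \<Rightarrow> nat set) \<Rightarrow> ('v \<Rightarrow> nat set) \<Rightarrow> bool" where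
  "bc_subdomains c D E \<longleftrightarrow>
     (\<forall>v\<in>set (scope c). E v \<subseteq> D v \<and> (\<exists>a b. E v = {a..b})) \<and> bound_consistent c E"

text \<open>The result of enforcing bound consistency on \<open>D\<close>; it is determined on the scope.  Intervals
  may be empty here, which is how enforcing bound consistency fails.\<close>

definition largest_bc_subdomains :: "'v constraint \<Rightarrow> ('v \<Rightarrow> nat set) \<Rightarrow> ('v \<Rightarrow> nat set) \<Rightarrow> bool" where
  "largest_bc_subdomains c D E \<longleftrightarrow>
     bc_subdomains c D E \<and>
     (\<forall>E'. bc_subdomains c D E' \<longrightarrow> (\<forall>v\<in>set (scope c). E' v \<subseteq> E v))"


section \<open>Logic programs and unit-propagation\<close>

text \<open>\<open>T x\<close> and \<open>F x\<close> assign a truth value to \<open>x\<close>; as literals in a rule body they stand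
  for \<open>x\<close> and \<open>not x\<close>.\<close>

datatype 'x signed = T 'x | F 'x

fun complement :: "'x signed \<Rightarrow> 'x signed" where
  "complement (T x) = F x"
| "complement (F x) = T x"

type_synonym 'a body = "'a signed set"

datatype 'a head = Normal 'a | Choice "'a set"

fun head_atoms :: "'a head \<Rightarrow> 'a set" where
  "head_atoms (Normal h) = {h}"
| "head_atoms (Choice H) = H"

type_synonym 'a program = "('a head \<times> 'a body) set"

definition program_atoms :: "'a program \<Rightarrow> 'a set" where
  "program_atoms P = (\<Union>(h, B)\<in>P. head_atoms h \<union> (\<Union>l\<in>B. set_signed l))"

datatype 'a item = Atom 'a | Body "'a body"

type_synonym 'a assignment = "'a item signed set"

abbreviation lit :: "'a signed \<Rightarrow> 'a item signed" where
  "lit \<equiv> map_signed Atom"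

text \<open>The nogoods of a program \<open>P\<close>, where \<open>bot\<close> is the always-false atom.  Rules with equal
  bodies share the corresponding item.\<close>

inductive_set nogoods :: "'a \<Rightarrow> 'a program \<Rightarrow> 'a assignment set"
  for bot :: 'a and P :: "'a program" where
  body_true: "(h, B) \<in> P \<Longrightarrow> insert (F (Body B)) (lit ` B) \<in> nogoods bot P"
| body_false: "(h, B) \<in> P \<Longrightarrow> l \<in> B \<Longrightarrow> {T (Body B), complement (lit l)} \<in> nogoods bot P"
| head_true: "(Normal h, B) \<in> P \<Longrightarrow> {T (Body B), F (Atom h)} \<in> nogoods bot P"
| support: "a \<in> program_atoms P \<Longrightarrow>
    insert (T (Atom a)) {F (Body B) |h B. (h, B) \<in> P \<and> a \<in> head_atoms h} \<in> nogoods bot P"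
| bot_false: "{T (Atom bot)} \<in> nogoods bot P"

text \<open>The fixpoint of unit-propagation from the assignment \<open>A\<close>.  If there is a conflict, this set
  may assign both truth values to an item.\<close>

inductive_set unit_propagation :: "'x signed set set \<Rightarrow> 'x signed set \<Rightarrow> 'x signed set"
  for N :: "'x signed set set" and A :: "'x signed set" where
  initial: "s \<in> A \<Longrightarrow> s \<in> unit_propagation N A"
| propagate: "G \<in> N \<Longrightarrow> s \<in> G \<Longrightarrow> \<forall>r\<in>G - {s}. r \<in> unit_propagation N A \<Longrightarrow>
    complement s \<in> unit_propagation N A"

definition conflict :: "'x signed set set \<Rightarrow> 'x signed set \<Rightarrow> bool" where
  "conflict N A \<longleftrightarrow> (\<exists>G\<in>N. G \<subseteq> A)"


section \<open>The bound encoding\<close>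

datatype 'v enc_atom =
  Bot | Bound 'v nat | Sat "'v constraint" | Violate "'v constraint"

text \<open>\<open>l\<close> and \<open>u\<close> describe the box of all tuples whose \<open>j\<close>-th entry lies in \<open>{l ! j<..u ! j}\<close>.\<close>

definition conflict_region :: "nat \<Rightarrow> 'v constraint \<Rightarrow> nat list \<Rightarrow> nat list \<Rightarrow> bool" where
  "conflict_region d c l u \<longleftrightarrow>
     length l = length (scope c) \<and> length u = length (scope c) \<and>
     (\<forall>j<length (scope c). l ! j < u ! j \<and> u ! j \<le> d) \<and>
     \<not> (\<exists>t\<in>allowed c. \<forall>j<length (scope c). l ! j < t ! j \<and> t ! j \<le> u ! j)"

definition region_body :: "'v constraint \<Rightarrow> nat list \<Rightarrow> nat list \<Rightarrow> 'v enc_atom body" where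
  "region_body c l u =
     {T (Bound (scope c ! j) (u ! j)) |j. j < length (scope c)} \<union>
     {F (Bound (scope c ! j) (l ! j)) |j. j < length (scope c) \<and> 0 < l ! j}"

definition bound_encoding :: "nat \<Rightarrow> 'v constraint \<Rightarrow> 'v enc_atom program" where
  "bound_encoding d c =
     {(Choice {Bound v i |i. 1 \<le> i \<and> i \<le> d}, {}) |v. v \<in> set (scope c)} \<union>
     {(Normal Bot, {T (Bound v i), F (Bound v (i + 1))}) |v i. v \<in> set (scope c) \<and> 1 \<le> i \<and> i < d} \<union>
     {(Normal Bot, {F (Bound v d)}) |v. v \<in> set (scope c)} \<union>
     {(Normal (Sat c), {F (Violate c)}), (Normal (Violate c), {F (Sat c)})} \<union>
     {(Normal (Violate c), region_body c l u) |l u. conflict_region d c l u}"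


section \<open>Enforcing bound consistency by unit-propagation\<close>

definition initial_assignment ::
    "'v constraint \<Rightarrow> ('v \<Rightarrow> nat) \<Rightarrow> ('v \<Rightarrow> nat) \<Rightarrow> 'v enc_atom assignment" where
  "initial_assignment c p q =
     {F (Atom (Violate c))} \<union>
     {F (Atom (Bound v (p v - 1))) |v. v \<in> set (scope c) \<and> p v > 1} \<union>
     {T (Atom (Bound v (q v))) |v. v \<in> set (scope c)}"

text \<open>The disjunct \<open>i = 0\<close> accounts for \<open>Bound v 0\<close>, which is regarded as false but is not
  an atom of the encoding.\<close>

definition domain_of :: "'v enc_atom assignment \<Rightarrow> 'v \<Rightarrow> nat set" where
  "domain_of A v =
     {(GREATEST i. i = 0 \<or> F (Atom (Bound v i)) \<in> A) + 1 .. (LEAST i. T (Atom (Bound v i)) \<in> A)}"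

definition enforces_bound_consistency :: "nat \<Rightarrow> 'v constraint \<Rightarrow> 'v enc_atom program \<Rightarrow> bool" where
  "enforces_bound_consistency d c P \<longleftrightarrow>
     (\<forall>p q. (\<forall>v\<in>set (scope c). 1 \<le> p v \<and> p v \<le> q v \<and> q v \<le> d) \<longrightarrow>
        (let N = nogoods Bot P;
             A = unit_propagation N (initial_assignment c p q)
         in \<exists>E. largest_bc_subdomains c (\<lambda>v. {p v..q v}) E \<and>
              (conflict N A \<longleftrightarrow> (\<exists>v\<in>set (scope c). E v = {})) \<and>
              (\<not> conflict N A \<longrightarrow> (\<forall>v\<in>set (scope c). domain_of A v = E v))))"

end

theory Submission
  imports Defs
begin

text \<open>Without a conflict, unit-propagation stops at an assignment whose bounds are bound
  consistent: if the lower or upper bound of some variable had no bound support, the box that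
  fixes this variable to that value and spans the current domains of the others would be a
  conflict region, and its rule would propagate a tighter bound.  Conversely, nonempty bound
  consistent domains give an assignment that violates no nogood and is closed under
  unit-propagation, because a region rule that propagates a tighter bound on them would exclude
  a bound support.  So the fixpoint lies inside this assignment, and it loses no value of the
  largest bound consistent subdomains.\<close>

section \<open>Largest bound consistent subdomains\<close>

lemma Min_interval: "x \<le> y \<Longrightarrow> Min {x..y} = x" for x y :: nat
  by (intro Min_eqI) auto

lemma Max_interval: "x \<le> y \<Longrightarrow> Max {x..y} = y" for x y :: nat
  by (intro Max_eqI) auto

text \<open>A bound support for \<open>Min (E v)\<close> requires the domain of every other variable
  to be nonempty, so emptiness is all-or-nothing on the scope.\<close>

lemma bound_consistent_nonempty:
  assumes "bound_consistent c E" "v \<in> set (scope c)" "E v \<noteq> {}" "w \<in> set (scope c)"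
  shows "E w \<noteq> {}"
proof -
  obtain i where i: "i < length (scope c)" "scope c ! i = v"
    using assms(2) by (auto simp: in_set_conv_nth)
  obtain j where j: "j < length (scope c)" "scope c ! j = w"
    using assms(4) by (auto simp: in_set_conv_nth)
  obtain t where "bound_support c E i (Min (E v)) t"
    using assms(1,3) i unfolding bound_consistent_def by blast
  then show ?thesis
    using i j assms(3) unfolding bound_support_def by (cases "i = j") auto
qed

text \<open>Finiteness makes \<open>Min\<close> and \<open>Max\<close> monotone under inclusion.
  This carries supports from one family of subdomains over to the hull of all of them.\<close>

lemma bound_support_mono:
  assumes "bound_support c E i x t"
    and "\<And>w. w \<in> set (scope c) \<Longrightarrow> E w \<subseteq> E' w"
    and "\<And>w. w \<in> set (scope c) \<Longrightarrow> finite (E' w)"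
  shows "bound_support c E' i x t"
proof -
  have "E' (scope c ! j) \<noteq> {} \<and> Min (E' (scope c ! j)) \<le> t ! j \<and> t ! j \<le> Max (E' (scope c ! j))"
    if "j < length (scope c)" "j \<noteq> i" for j
  proof -
    let ?w = "scope c ! j"
    have w: "?w \<in> set (scope c)" using that by simp
    have "E ?w \<noteq> {}" and t: "Min (E ?w) \<le> t ! j" "t ! j \<le> Max (E ?w)"
      using assms(1) that unfolding bound_support_def by auto
    moreover have "Min (E' ?w) \<le> Min (E ?w)" "Max (E ?w) \<le> Max (E' ?w)"
      using \<open>E ?w \<noteq> {}\<close> assms(2,3)[OF w] by (auto intro: Min_antimono Max_mono)
    ultimately show ?thesis using assms(2)[OF w] by auto
  qed
  then show ?thesis using assms(1) unfolding bound_support_def by blast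
qed

text \<open>If some bound consistent subdomain is nonempty, the largest ones are the hulls of the
  unions of all such subdomains: each endpoint of a hull is attained in some family, whose bound
  support remains valid in the hull.\<close>

lemma largest_bc_subdomains_cases:
  fixes c :: "'v constraint"
  assumes D: "\<And>v. v \<in> set (scope c) \<Longrightarrow> finite (D v)"
    and D_interval: "\<And>v. v \<in> set (scope c) \<Longrightarrow> \<exists>x y. D v = {x..y}"
  obtains (empty) "largest_bc_subdomains c D (\<lambda>_. {})"
  | (nonempty) a b where "largest_bc_subdomains c D (\<lambda>v. {a v..b v})"
      "\<And>v. v \<in> set (scope c) \<Longrightarrow> a v \<le> b v"
proof (cases "\<exists>E. bc_subdomains c D E \<and> (\<exists>v\<in>set (scope c). E v \<noteq> {})")
  case False
  have "\<exists>x y::nat. {} = {x..y}"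
    by (rule exI[of _ 1], rule exI[of _ 0]) simp
  then have "bc_subdomains c D (\<lambda>_. {})"
    unfolding bc_subdomains_def bound_consistent_def by simp
  with False have "largest_bc_subdomains c D (\<lambda>_. {})"
    unfolding largest_bc_subdomains_def by blast
  then show ?thesis by (rule empty)
next
  case True
  then obtain E0 v0 where E0: "bc_subdomains c D E0" "v0 \<in> set (scope c)" "E0 v0 \<noteq> {}" by blast
  define X where "X v = {x. \<exists>E. bc_subdomains c D E \<and> x \<in> E v}" for v
  define a where "a v = Min (X v)" for v
  define b where "b v = Max (X v)" for v
  have XD: "X v \<subseteq> D v" if "v \<in> set (scope c)" for v
    using that unfolding X_def bc_subdomains_def by blast
  have X: "finite (X v)" "X v \<noteq> {}" if v: "v \<in> set (scope c)" for v
  proof -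
    show "finite (X v)" using XD[OF v] D[OF v] finite_subset by blast
    have "E0 v \<noteq> {}"
      using bound_consistent_nonempty[of c E0] E0 v unfolding bc_subdomains_def by blast
    then show "X v \<noteq> {}" using E0(1) unfolding X_def by blast
  qed
  have ab: "a v \<in> X v" "b v \<in> X v" "a v \<le> b v" if "v \<in> set (scope c)" for v
    using X[OF that] by (auto simp: a_def b_def)
  have hull: "E v \<subseteq> {a v..b v}" if "bc_subdomains c D E" "v \<in> set (scope c)" for E v
    proof
    fix x assume "x \<in> E v"
    then have "x \<in> X v" using that(1) unfolding X_def by blast
    then show "x \<in> {a v..b v}" using X(1)[OF that(2)] by (simp add: a_def b_def)
  qed
  have extreme: "\<exists>t. bound_support c (\<lambda>v. {a v..b v}) i x t"
    if i: "i < length (scope c)" and x: "x \<in> {a (scope c ! i), b (scope c ! i)}" for i x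
  proof -
    let ?v = "scope c ! i"
    have v: "?v \<in> set (scope c)" using i by simp
    obtain E where E: "bc_subdomains c D E" "x \<in> E ?v"
      using ab[OF v] x unfolding X_def by auto
    have fin: "finite (E ?v)" using hull[OF E(1) v] finite_subset by blast
    \<comment> \<open>\<open>E ?v\<close> lies inside the hull and contains the endpoint
      \<open>x\<close> of the hull, so \<open>x\<close> is an endpoint of \<open>E ?v\<close> as
      well.\<close>
    have "x \<in> {Min (E ?v), Max (E ?v)}"
    proof (cases "x = a ?v")
      case True
      have "Min (E ?v) = x"
        using True E(2) hull[OF E(1) v] fin by (intro Min_eqI) auto
      then show ?thesis by simp
    next
      case False
      have "Max (E ?v) = x"
        using False x E(2) hull[OF E(1) v] fin by (intro Max_eqI) auto
      then show ?thesis by simp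
    qed
    then obtain t where "bound_support c E i x t"
      using E i unfolding bc_subdomains_def bound_consistent_def by blast
    then have "bound_support c (\<lambda>v. {a v..b v}) i x t"
      by (rule bound_support_mono) (use hull[OF E(1)] in auto)
    then show ?thesis ..
  qed
  have "{a v..b v} \<subseteq> D v" if v: "v \<in> set (scope c)" for v
  proof -
    obtain x y where "D v = {x..y}" using D_interval[OF v] by blast
    then show ?thesis using ab[OF v] XD[OF v] by auto
  qed
  moreover have "bound_consistent c (\<lambda>v. {a v..b v})"
    unfolding bound_consistent_def
  proof (intro allI impI)
    fix i assume "i < length (scope c)"
    then show "\<forall>x\<in>{Min {a (scope c ! i)..b (scope c ! i)}, Max {a (scope c ! i)..b (scope c ! i)}}.
        \<exists>t. bound_support c (\<lambda>v. {a v..b v}) i x t"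
      using extreme[of i] ab(3)[of "scope c ! i"] by (simp add: Min_interval Max_interval)
  qed
  ultimately have "bc_subdomains c D (\<lambda>v. {a v..b v})"
    unfolding bc_subdomains_def by blast
  then have "largest_bc_subdomains c D (\<lambda>v. {a v..b v})"
    using hull unfolding largest_bc_subdomains_def by blast
  then show ?thesis using ab(3) by (rule nonempty)
qed

section \<open>Unit-propagation\<close>

lemma complement_complement [simp]: "complement (complement s) = s"
  by (cases s) auto

lemma complement_neq [simp]: "complement s \<noteq> s"
  by (cases s) auto

definition consistent :: "'x signed set \<Rightarrow> bool" where
  "consistent A \<longleftrightarrow> (\<forall>s\<in>A. complement s \<notin> A)"

text \<open>A propagated literal is the complement of some \<open>r\<close> in a nogood whose other
  elements hold. If \<open>r\<close> held too, the nogood would be a conflict. Hence a clash could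
  only stem from two literals of \<open>A\<close>.\<close>

lemma unit_propagation_consistent:
  assumes "consistent A" "\<not> conflict N (unit_propagation N A)"
  shows "consistent (unit_propagation N A)"
proof -
  let ?U = "unit_propagation N A"
  have derived: "complement s \<notin> ?U" if "s \<in> ?U" "s \<notin> A" for s
    using that(1)
  proof cases
    case initial
    with that(2) show ?thesis by simp
  next
    case (propagate G r)
    then show ?thesis using assms(2) unfolding conflict_def by auto
  qed
  show ?thesis
    unfolding consistent_def
  proof
    fix s assume s: "s \<in> ?U"
    show "complement s \<notin> ?U"
    proof
      assume "complement s \<in> ?U"
      then have "complement s \<in> A" "s \<in> A"
        using derived[of "complement s"] derived[of s] s by auto
      then show False using assms(1) unfolding consistent_def by blast
    qed
  qed
qed

text \<open>For consistent \<open>S\<close>, such a nogood adds nothing to \<open>S\<close> and is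
  not violated: either an element is already refuted, or two elements do not hold.\<close>

definition inert :: "'x signed set \<Rightarrow> 'x signed set \<Rightarrow> bool" where
  "inert S G \<longleftrightarrow>
     (\<exists>r\<in>G. complement r \<in> S) \<or> (\<exists>r\<in>G. \<exists>r'\<in>G. r \<noteq> r' \<and> r \<notin> S \<and> r' \<notin> S)"

lemma inertI1: "r \<in> G \<Longrightarrow> complement r \<in> S \<Longrightarrow> inert S G"
  unfolding inert_def by blast

lemma inertI2: "r \<in> G \<Longrightarrow> r' \<in> G \<Longrightarrow> r \<noteq> r' \<Longrightarrow> r \<notin> S \<Longrightarrow> r' \<notin> S \<Longrightarrow> inert S G"
  unfolding inert_def by blast

lemma unit_propagation_inert:
  assumes S: "consistent S" and N: "\<And>G. G \<in> N \<Longrightarrow> inert S G" and "A \<subseteq> S"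
  shows "unit_propagation N A \<subseteq> S" and "\<not> conflict N (unit_propagation N A)"
proof -
  show sub: "unit_propagation N A \<subseteq> S"
  proof
    fix s assume "s \<in> unit_propagation N A"
    then show "s \<in> S"
    proof induction
      case (initial s)
      then show ?case using assms(3) by blast
    next
      case (propagate G s)
      then have G: "G - {s} \<subseteq> S" by blast
      \<comment> \<open>Only \<open>s\<close> can lie outside \<open>S\<close>, which rules out the
        second alternative of \<open>inert\<close>.\<close>
      have "\<exists>r\<in>G. complement r \<in> S"
        using N[OF propagate(1)] G unfolding inert_def by blast
      then obtain r where r: "r \<in> G" "complement r \<in> S" by blast
      then have "r = s"
        using G S unfolding consistent_def by (metis DiffI singletonD subsetD)
      then show ?case using r by simp
    qed
  qed
  have "\<not> G \<subseteq> S" if "G \<in> N" for G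
    using N[OF that] S unfolding inert_def consistent_def by (metis subsetD)
  then show "\<not> conflict N (unit_propagation N A)"
    using sub unfolding conflict_def by blast
qed

section \<open>The bound encoding\<close>

lemma bound_encoding_cases:
  assumes "(h, B) \<in> bound_encoding d c"
  obtains (choice) v where "v \<in> set (scope c)" "h = Choice {Bound v i |i. 1 \<le> i \<and> i \<le> d}" "B = {}"
  | (order) v i where "v \<in> set (scope c)" "1 \<le> i" "i < d" "h = Normal Bot"
      "B = {T (Bound v i), F (Bound v (i + 1))}"
  | (top) v where "v \<in> set (scope c)" "h = Normal Bot" "B = {F (Bound v d)}"
  | (sat) "h = Normal (Sat c)" "B = {F (Violate c)}"
  | (violate) "h = Normal (Violate c)" "B = {F (Sat c)}"
  | (region) l u where "conflict_region d c l u" "h = Normal (Violate c)" "B = region_body c l u"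
  using assms unfolding bound_encoding_def by auto

lemma region_body_literal:
  assumes "conflict_region d c l u" "s \<in> region_body c l u"
  obtains v i where "v \<in> set (scope c)" "1 \<le> i" "i \<le> d" "set_signed s = {Bound v i}"
proof -
  obtain j where j: "j < length (scope c)"
    "s = T (Bound (scope c ! j) (u ! j)) \<or> s = F (Bound (scope c ! j) (l ! j)) \<and> 0 < l ! j"
    using assms(2) unfolding region_body_def by blast
  then have "l ! j < u ! j" "u ! j \<le> d" "scope c ! j \<in> set (scope c)"
    using assms(1) unfolding conflict_region_def by auto
  then show ?thesis
    using j(2) that[of "scope c ! j" "u ! j"] that[of "scope c ! j" "l ! j"] by auto
qed

text \<open>The assumption \<open>d \<ge> 1\<close> puts the atom \<open>Bound v d\<close> of the
  rule \<open>Bot\<close> from \<open>not Bound v d\<close> into the index range.\<close>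

lemma program_atoms_bound_encoding:
  assumes "x \<in> program_atoms (bound_encoding d c)" "d \<ge> 1"
  shows "x \<in> {Bot, Sat c, Violate c} \<or> (\<exists>v i. v \<in> set (scope c) \<and> 1 \<le> i \<and> i \<le> d \<and> x = Bound v i)"
proof -
  obtain h B where hB: "(h, B) \<in> bound_encoding d c"
    and x: "x \<in> head_atoms h \<union> (\<Union>s\<in>B. set_signed s)"
    using assms(1) unfolding program_atoms_def by blast
  from hB show ?thesis
  proof (cases rule: bound_encoding_cases)
    case (region l u)
    then consider "x = Violate c" | s where "s \<in> region_body c l u" "x \<in> set_signed s"
      using x by auto
    then show ?thesis
    proof cases
      case (2 s)
      then show ?thesis by (elim region_body_literal[OF region(1)]) auto
    qed simp
  qed (use x assms(2) in auto)
qed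

lemma nogood_atoms:
  assumes "G \<in> nogoods z P" "s \<in> G" "Atom x \<in> set_signed s"
  shows "x = z \<or> x \<in> program_atoms P"
  using assms(1)
proof cases
  case (body_true h B)
  then obtain r where "r \<in> B" "s = lit r" using assms(2,3) by auto
  then show ?thesis using assms(3) body_true
    unfolding program_atoms_def by (cases r) force+
next
  case (body_false h B l)
  then have "s = complement (lit l)" using assms(2,3) by auto
  then show ?thesis using assms(3) body_false
    unfolding program_atoms_def by (cases l) force+
next
  case (head_true h B)
  then show ?thesis using assms(2,3) unfolding program_atoms_def by force
qed (use assms in auto)

lemma set_signed_complement [simp]: "set_signed (complement s) = set_signed s"
  by (cases s) auto

text \<open>Propagation assigns only items that occur in nogoods. The resulting index range bounds
  the set over which \<open>domain_of\<close> takes \<open>GREATEST\<close>.\<close>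

lemma unit_propagation_Bound:
  assumes "d \<ge> 1" "s \<in> unit_propagation (nogoods Bot (bound_encoding d c)) A"
    and "Atom (Bound v i) \<in> set_signed s"
    and "\<And>r. r \<in> A \<Longrightarrow> Atom (Bound v i) \<in> set_signed r \<Longrightarrow> 1 \<le> i \<and> i \<le> d"
  shows "1 \<le> i \<and> i \<le> d"
  using assms(2,3)
proof cases
  case initial
  then show ?thesis using assms(3,4) by blast
next
  case (propagate G r)
  then show ?thesis
    using nogood_atoms[of G Bot "bound_encoding d c" r "Bound v i"] assms(1,3)
      program_atoms_bound_encoding[of "Bound v i" d c] by simp
qed

section \<open>Nonempty bound consistent domains resist unit-propagation\<close>

text \<open>The intended closed assignment for the domains \<open>{a v..b v}\<close> with
  \<open>c\<close> required: for scope variables, \<open>Bound v i\<close> stays open exactly when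
  \<open>a v \<le> i < b v\<close>. The region bodies are false because their head is.\<close>

definition domain_assignment ::
    "nat \<Rightarrow> 'v constraint \<Rightarrow> ('v \<Rightarrow> nat) \<Rightarrow> ('v \<Rightarrow> nat) \<Rightarrow> 'v enc_atom assignment" where
  "domain_assignment d c a b =
     {F (Atom (Violate c)), T (Atom (Sat c)), F (Atom Bot),
      T (Body {F (Violate c)}), F (Body {F (Sat c)}), T (Body {})} \<union>
     {F (Atom (Bound v i)) |v i. v \<in> set (scope c) \<and> 1 \<le> i \<and> i < a v} \<union>
     {T (Atom (Bound v i)) |v i. v \<in> set (scope c) \<and> b v \<le> i \<and> i \<le> d} \<union>
     {F (Body {T (Bound v i), F (Bound v (i + 1))}) |v i. v \<in> set (scope c) \<and> 1 \<le> i \<and> i < d} \<union>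
     {F (Body {F (Bound v d)}) |v. v \<in> set (scope c)} \<union>
     {F (Body (region_body c l u)) |l u. conflict_region d c l u}"

lemma region_body_T_Bound:
  "j < length (scope c) \<Longrightarrow> T (Bound (scope c ! j) (u ! j)) \<in> region_body c l u"
  unfolding region_body_def by blast

lemma region_body_F_Bound:
  "j < length (scope c) \<Longrightarrow> 0 < l ! j \<Longrightarrow> F (Bound (scope c ! j) (l ! j)) \<in> region_body c l u"
  unfolding region_body_def by blast

text \<open>Bodies are identified by their literals, so a region body must not coincide with
  \<open>{}\<close> or \<open>{F (Violate c)}\<close>, which \<open>domain_assignment\<close> makes
  true.\<close>

lemma region_body_neq:
  assumes "scope c \<noteq> []"
  shows "region_body c l u \<noteq> {}" "region_body c l u \<noteq> {F x}"
  using region_body_T_Bound[of 0 c u l] assms by auto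

context
  fixes d :: nat and c :: "'v constraint" and a b :: "'v \<Rightarrow> nat"
  assumes constraint: "is_constraint d c"
    and bounds: "\<And>v. v \<in> set (scope c) \<Longrightarrow> 1 \<le> a v \<and> a v \<le> b v \<and> b v \<le> d"
    and bc: "bound_consistent c (\<lambda>v. {a v..b v})"
begin

text \<open>A clash on a bound atom would need \<open>b v \<le> i < a v\<close>; the only true
  bodies differ from all false ones.\<close>

lemma consistent_domain_assignment: "consistent (domain_assignment d c a b)"
  (is "consistent ?S")
proof -
  have "scope c \<noteq> []" using constraint unfolding is_constraint_def by simp
  note neq = region_body_neq[OF this]
  have False if pos: "T x \<in> ?S" and neg: "F x \<in> ?S" for x
  proof (cases x)
    case (Atom y)
    then show False using pos neg bounds
      by (cases y) (force simp: domain_assignment_def)+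
  next
    case (Body B)
    then have "B = {F (Violate c)} \<or> B = {}"
      using pos unfolding domain_assignment_def by simp
    moreover have "F (Body {F (Violate c)}) \<notin> ?S" "F (Body {}) \<notin> ?S"
      using neq unfolding domain_assignment_def by (auto dest: sym)
    ultimately show False using neg Body by blast
  qed
  then show ?thesis
    unfolding consistent_def by (metis complement.elims)
qed

lemma extreme_support:
  assumes i: "i < length (scope c)" and x: "x \<in> {a (scope c ! i), b (scope c ! i)}"
  obtains t where "t \<in> allowed c" "t ! i = x"
    "\<And>j. j < length (scope c) \<Longrightarrow> j \<noteq> i \<Longrightarrow> a (scope c ! j) \<le> t ! j \<and> t ! j \<le> b (scope c ! j)"
proof -
  have ab: "a (scope c ! j) \<le> b (scope c ! j)" if "j < length (scope c)" for j
    using bounds that by simp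
  have "x \<in> {Min {a (scope c ! i)..b (scope c ! i)}, Max {a (scope c ! i)..b (scope c ! i)}}"
    using x Min_interval[OF ab[OF i]] Max_interval[OF ab[OF i]] by simp
  moreover have "{a (scope c ! i)..b (scope c ! i)} \<noteq> {}" using ab[OF i] by simp
  ultimately obtain t where t: "bound_support c (\<lambda>v. {a v..b v}) i x t"
    using bc i unfolding bound_consistent_def by blast
  show ?thesis
  proof (rule that)
    show "t \<in> allowed c" "t ! i = x" using t unfolding bound_support_def by auto
    show "a (scope c ! j) \<le> t ! j \<and> t ! j \<le> b (scope c ! j)"
      if "j < length (scope c)" "j \<noteq> i" for j
    proof -
      have "Min {a (scope c ! j)..b (scope c ! j)} \<le> t ! j"
        "t ! j \<le> Max {a (scope c ! j)..b (scope c ! j)}"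
        using t that unfolding bound_support_def by blast+
      then show ?thesis using ab[OF that(1)] by (simp add: Min_interval Max_interval)
    qed
  qed
qed

text \<open>If the box misses the domain of some variable, a body literal is already refuted.
  Otherwise two literals are open, since with at most one open the box would contain a bound
  support.\<close>

lemma region_inert:
  assumes region: "conflict_region d c l u"
  shows "inert (domain_assignment d c a b) (insert (F (Body B)) (lit ` region_body c l u))"
    (is "inert ?S ?G")
proof -
  let ?n = "length (scope c)"
  let ?v = "\<lambda>j. scope c ! j"
  let ?T = "\<lambda>j. T (Atom (Bound (?v j) (u ! j)))"
  let ?F = "\<lambda>j. F (Atom (Bound (?v j) (l ! j)))"
  have n: "0 < ?n" and dist: "distinct (scope c)"
    using constraint unfolding is_constraint_def by auto
  have lu: "l ! j < u ! j" "u ! j \<le> d" if "j < ?n" for j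
    using region that unfolding conflict_region_def by auto
  have no: "\<not> (\<forall>j<?n. l ! j < t ! j \<and> t ! j \<le> u ! j)" if "t \<in> allowed c" for t
    using region that unfolding conflict_region_def by blast
  have TG: "?T j \<in> ?G" if "j < ?n" for j
    using imageI[OF region_body_T_Bound[OF that], of lit] by simp
  have FG: "?F j \<in> ?G" if "j < ?n" "0 < l ! j" for j
    using imageI[OF region_body_F_Bound[OF that], of lit] by simp
  have ab_pos: "0 < a (?v j)" "a (?v j) \<le> b (?v j)" if "j < ?n" for j
    using bounds[of "?v j"] that by auto
  show ?thesis
  proof (cases "\<exists>j<?n. u ! j < a (?v j) \<or> b (?v j) \<le> l ! j")
    case True
    then obtain j where j: "j < ?n" "u ! j < a (?v j) \<or> b (?v j) \<le> l ! j" by blast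
    from j(2) show ?thesis
    proof
      assume "u ! j < a (?v j)"
      then have "complement (?T j) \<in> ?S"
        using lu[OF j(1)] j(1) unfolding domain_assignment_def by simp
      then show ?thesis using TG[OF j(1)] by (rule inertI1[rotated])
    next
      assume *: "b (?v j) \<le> l ! j"
      then have "complement (?F j) \<in> ?S"
        using lu[OF j(1)] j(1) unfolding domain_assignment_def by simp
      moreover have "0 < l ! j" using * ab_pos[OF j(1)] by simp
      ultimately show ?thesis using FG[OF j(1)] by (blast intro: inertI1)
    qed
  next
    case False
    then have box: "a (?v j) \<le> u ! j" "l ! j < b (?v j)" if "j < ?n" for j
      using that by (meson not_le)+
    have T_iff: "?T j \<in> ?S \<longleftrightarrow> b (?v j) \<le> u ! j" if "j < ?n" for j
      using that lu[OF that] unfolding domain_assignment_def by auto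
    have F_iff: "?F j \<in> ?S \<longleftrightarrow> l ! j < a (?v j)" if "j < ?n" "0 < l ! j" for j
      using that unfolding domain_assignment_def by auto
    have False if free: "\<And>r r'. r \<in> ?G \<Longrightarrow> r' \<in> ?G \<Longrightarrow> r \<notin> ?S \<Longrightarrow> r' \<notin> ?S \<Longrightarrow> r = r'"
    proof -
      let ?wide = "\<lambda>j. l ! j < a (?v j) \<and> b (?v j) \<le> u ! j"
      \<comment> \<open>At most one body literal is unassigned, so the box cuts the domain of at most the variable
        \<open>i\<close>, and it keeps one of the two bounds of that domain.\<close>
      define i where "i = (if \<exists>i<?n. \<not> ?wide i then SOME i. i < ?n \<and> \<not> ?wide i else 0)"
      \<comment> \<open>If the box covers every domain, the default index 0 serves; it is valid
        because the scope is nonempty.\<close>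
      have i: "i < ?n" "(\<exists>i<?n. \<not> ?wide i) \<Longrightarrow> \<not> ?wide i"
        using n someI_ex[of "\<lambda>i. i < ?n \<and> \<not> ?wide i"] unfolding i_def by auto
      \<comment> \<open>Two domains cut by the box would give open literals over different
        variables, hence two distinct ones, against \<open>free\<close>.\<close>
      have others: "?wide j" if j: "j < ?n" "j \<noteq> i" for j
      proof (rule ccontr)
        assume nj: "\<not> ?wide j"
        have free_lit: "\<exists>r\<in>?G. r \<notin> ?S \<and> (\<exists>k. set_signed r = {Atom (Bound (?v m) k)})"
          if m: "m < ?n" "\<not> ?wide m" for m
        proof (cases "l ! m < a (?v m)")
          case True
          then have "?T m \<notin> ?S" using m T_iff by blast
          then show ?thesis using TG[OF m(1)] by (intro bexI[of _ "?T m"]) auto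
        next
          case False
          then have *: "0 < l ! m" using ab_pos[OF m(1)] by linarith
          then have "?F m \<notin> ?S" using m False F_iff by blast
          then show ?thesis using FG[OF m(1) *] by (intro bexI[of _ "?F m"]) auto
        qed
        obtain r k where r: "r \<in> ?G" "r \<notin> ?S" "set_signed r = {Atom (Bound (?v j) k)}"
          using free_lit[OF j(1) nj] by blast
        obtain r' k' where r': "r' \<in> ?G" "r' \<notin> ?S" "set_signed r' = {Atom (Bound (?v i) k')}"
          using free_lit[OF i(1)] i(2) j(1) nj by blast
        have "r = r'" using free r r' by blast
        then have "?v j = ?v i" using r(3) r'(3) by simp
        then show False using j i(1) dist by (simp add: nth_eq_iff_index_eq)
      qed
      \<comment> \<open>If the box lost both endpoints while meeting the domain, it would lie
        strictly inside, leaving both literals of variable \<open>i\<close> open.\<close>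
      have "\<exists>x\<in>{a (?v i), b (?v i)}. l ! i < x \<and> x \<le> u ! i"
      proof (rule ccontr)
        assume neg: "\<not> ?thesis"
        then have *: "a (?v i) \<le> l ! i" "u ! i < b (?v i)"
          using box[OF i(1)] by auto
        then have pos: "0 < l ! i" using ab_pos[OF i(1)] by linarith
        have "?T i = ?F i"
          using free[OF TG[OF i(1)] FG[OF i(1) pos]] T_iff[OF i(1)] F_iff[OF i(1) pos] * by auto
        then show False by simp
      qed
      then obtain x where x: "x \<in> {a (?v i), b (?v i)}" "l ! i < x" "x \<le> u ! i" by blast
      obtain t where t: "t \<in> allowed c" "t ! i = x"
        "\<And>j. j < ?n \<Longrightarrow> j \<noteq> i \<Longrightarrow> a (?v j) \<le> t ! j \<and> t ! j \<le> b (?v j)"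
        using extreme_support[OF i(1) x(1)] by blast
      have "\<forall>j<?n. l ! j < t ! j \<and> t ! j \<le> u ! j"
        using t x others by (metis le_trans less_le_trans)
      then show False using no[OF t(1)] by blast
    qed
    then show ?thesis unfolding inert_def by blast
  qed
qed

text \<open>Only the body nogoods of order and region rules may rely on two open elements; every
  other nogood has an element that is already refuted.\<close>

lemma bound_encoding_inert:
  assumes "G \<in> nogoods Bot (bound_encoding d c)"
  shows "inert (domain_assignment d c a b) G" (is "inert ?S G")
  using assms
proof cases
  case (body_true h B)
  from body_true(2) show ?thesis
  proof (cases rule: bound_encoding_cases)
    case (order v i)
    let ?t = "T (Atom (Bound v i))" and ?f = "F (Atom (Bound v (i + 1)))"
    have in_G: "?t \<in> G" "?f \<in> G" using body_true(1) order by auto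
    \<comment> \<open>These are the cases \<open>i < a v\<close>, \<open>b v \<le> i + 1\<close>,
      and both indices in the open range.\<close>
    consider "complement ?t \<in> ?S" | "complement ?f \<in> ?S" | "?t \<notin> ?S" "?f \<notin> ?S"
      using order bounds[of v] unfolding domain_assignment_def by fastforce
    then show ?thesis
      using in_G by cases (blast intro: inertI1 inertI2)+
  next
    case (region l u)
    then show ?thesis using region_inert body_true(1) by simp
  qed (use body_true(1) bounds in \<open>auto intro!: inertI1[of "F (Body B)"] inertI1[of "F (Atom (Bound v d))" for v]
         inertI1[of "F (Atom (Sat c))"] simp: domain_assignment_def inert_def\<close>)
next
  case (body_false h B l)
  show ?thesis
  proof (cases "F (Body B) \<in> ?S")
    case True
    then show ?thesis using body_false by (intro inertI1[of "T (Body B)"]) auto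
  next
    case False
    \<comment> \<open>The only bodies not made false are \<open>{}\<close>, which has no literal,
      and \<open>{F (Violate c)}\<close>.\<close>
    have "l = F (Violate c)"
      using body_false(2,3) False by (cases rule: bound_encoding_cases) (auto simp: domain_assignment_def)
    then show ?thesis using body_false(1)
      by (intro inertI1[of "T (Atom (Violate c))"]) (auto simp: domain_assignment_def)
  qed
next
  case (head_true h B)
  show ?thesis
  proof (cases "F (Body B) \<in> ?S")
    case True
    then show ?thesis using head_true by (intro inertI1[of "T (Body B)"]) auto
  next
    case False
    have "h = Sat c"
      using head_true(2) False by (cases rule: bound_encoding_cases) (auto simp: domain_assignment_def)
    then show ?thesis using head_true(1)
      by (intro inertI1[of "F (Atom (Sat c))"]) (auto simp: domain_assignment_def)
  qed
next
  \<comment> \<open>\<open>Sat c\<close> is supported by the true body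
    \<open>{F (Violate c)}\<close>, and bound atoms by the empty body of their choice rule.\<close>
  case (support x)
  obtain v where v: "v \<in> set (scope c)"
    using constraint unfolding is_constraint_def by (cases "scope c") auto
  then have "1 \<le> d" using bounds[OF v] by linarith
  then consider "x \<in> {Bot, Violate c}" | "x = Sat c"
    | v i where "v \<in> set (scope c)" "1 \<le> i" "i \<le> d" "x = Bound v i"
    using program_atoms_bound_encoding[OF support(2)] by auto
  then show ?thesis
  proof cases
    case 1
    then show ?thesis using support(1)
      by (intro inertI1[of "T (Atom x)"]) (auto simp: domain_assignment_def)
  next
    case 2
    then have "(Normal (Sat c), {F (Violate c)}) \<in> bound_encoding d c" "x \<in> head_atoms (Normal (Sat c))"
      by (auto simp: bound_encoding_def)
    then have "F (Body {F (Violate c)}) \<in> G" unfolding support(1) by blast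
    then show ?thesis by (rule inertI1) (simp add: domain_assignment_def)
  next
    case 3
    let ?h = "Choice {Bound v i |i. 1 \<le> i \<and> i \<le> d}"
    have "(?h, {}) \<in> bound_encoding d c" "x \<in> head_atoms ?h"
      using 3 by (auto simp: bound_encoding_def)
    then have "F (Body {}) \<in> G" unfolding support(1) by blast
    then show ?thesis by (rule inertI1) (simp add: domain_assignment_def)
  qed
next
  case bot_false
  then show ?thesis by (intro inertI1[of "T (Atom Bot)"]) (auto simp: domain_assignment_def)
qed

end

section \<open>Fixpoints without conflict are bound consistent\<close>

lemma initial_assignment_Bound:
  assumes "\<forall>v\<in>set (scope c). 1 \<le> p v \<and> p v \<le> q v \<and> q v \<le> d"
    and "r \<in> initial_assignment c p q" "Atom (Bound v i) \<in> set_signed r"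
  shows "1 \<le> i \<and> i \<le> d"
proof -
  have "v \<in> set (scope c) \<and> (i = p v - 1 \<and> 1 < p v \<or> i = q v)"
    using assms(2,3) unfolding initial_assignment_def by auto
  moreover from this have "1 \<le> p v" "p v \<le> q v" "q v \<le> d" using assms(1) by auto
  ultimately show ?thesis by auto
qed

text \<open>The two initial bounds of a variable cannot clash because
  \<open>p v - 1 < q v\<close>.\<close>

lemma initial_assignment_consistent:
  assumes "\<forall>v\<in>set (scope c). 1 \<le> p v \<and> p v \<le> q v \<and> q v \<le> d"
  shows "consistent (initial_assignment c p q)"
proof -
  have neq: False if "v \<in> set (scope c)" "Suc 0 < p v" "p v - Suc 0 = q v" for v
  proof -
    have "p v \<le> q v" using assms that(1) by blast
    then show ?thesis using that(2,3) by linarith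
  qed
  show ?thesis
    unfolding consistent_def initial_assignment_def by (auto dest: neq neq[OF _ _ sym])
qed

context
  fixes d :: nat and c :: "'v constraint" and p q :: "'v \<Rightarrow> nat" and A :: "'v enc_atom assignment"
  assumes constraint: "is_constraint d c"
    and pq: "\<forall>v\<in>set (scope c). 1 \<le> p v \<and> p v \<le> q v \<and> q v \<le> d"
    and A_def: "A = unit_propagation (nogoods Bot (bound_encoding d c)) (initial_assignment c p q)"
    and no_conflict: "\<not> conflict (nogoods Bot (bound_encoding d c)) A"
begin

text \<open>This is one less than the least value of the current domain; 0 means that nothing is cut
  off from below.\<close>

abbreviation lower :: "'v \<Rightarrow> nat" where
  "lower v \<equiv> GREATEST i. i = 0 \<or> F (Atom (Bound v i)) \<in> A"

abbreviation upper :: "'v \<Rightarrow> nat" where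
  "upper v \<equiv> LEAST i. T (Atom (Bound v i)) \<in> A"

lemma initial_in: "s \<in> initial_assignment c p q \<Longrightarrow> s \<in> A"
  unfolding A_def by (rule unit_propagation.initial)

lemma propagated:
  "G \<in> nogoods Bot (bound_encoding d c) \<Longrightarrow> s \<in> G \<Longrightarrow> (\<And>r. r \<in> G \<Longrightarrow> r \<noteq> s \<Longrightarrow> r \<in> A) \<Longrightarrow>
    complement s \<in> A"
  unfolding A_def by (rule unit_propagation.propagate) auto

lemma not_both: "s \<in> A \<Longrightarrow> complement s \<notin> A"
  using unit_propagation_consistent[OF initial_assignment_consistent[OF pq]] no_conflict
  unfolding A_def consistent_def by blast

lemma Bound_range:
  assumes "s \<in> A" "Atom (Bound v i) \<in> set_signed s"
  shows "1 \<le> i" "i \<le> d"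
proof -
  obtain w where "w \<in> set (scope c)"
    using constraint unfolding is_constraint_def by (cases "scope c") auto
  then have "1 \<le> p w" "p w \<le> q w" "q w \<le> d" using pq by auto
  then have "1 \<le> d" by linarith
  then have "1 \<le> i \<and> i \<le> d"
    using unit_propagation_Bound[OF _ assms[unfolded A_def]] initial_assignment_Bound[OF pq] by blast
  then show "1 \<le> i" "i \<le> d" by auto
qed

lemma F_Body:
  assumes rule: "(Normal h, B) \<in> bound_encoding d c" and h: "F (Atom h) \<in> A"
  shows "F (Body B) \<in> A"
  using propagated[OF nogoods.head_true[OF rule], of "T (Body B)"] h by auto

lemma F_Bot: "F (Atom Bot) \<in> A"
  using propagated[OF nogoods.bot_false, of "T (Atom Bot)"] by auto

text \<open>The false head makes the body false, and then the nogood defining the body leaves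
  \<open>lit r\<close> as its only unassigned or refuted element.\<close>

lemma body_literal_refuted:
  assumes rule: "(Normal h, B) \<in> bound_encoding d c" and h: "F (Atom h) \<in> A"
    and r: "r \<in> B" and others: "\<And>s. s \<in> B \<Longrightarrow> s \<noteq> r \<Longrightarrow> lit s \<in> A"
  shows "complement (lit r) \<in> A"
proof (rule propagated[OF nogoods.body_true[OF rule]])
  show "lit r \<in> insert (F (Body B)) (lit ` B)" using r by simp
next
  fix s assume "s \<in> insert (F (Body B)) (lit ` B)" "s \<noteq> lit r"
  then show "s \<in> A" using F_Body[OF rule h] others by blast
qed

text \<open>The order rules have the false head \<open>Bot\<close>, so a true
  \<open>Bound v m\<close> forces \<open>Bound v (m + 1)\<close>.\<close>

lemma T_Bound_mono:
  assumes v: "v \<in> set (scope c)" and i: "T (Atom (Bound v i)) \<in> A" and "i \<le> k" "k \<le> d"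
  shows "T (Atom (Bound v k)) \<in> A"
  using assms(3,4)
proof (induction k rule: dec_induct)
  case base
  show ?case by (rule i)
next
  case (step m)
  have "1 \<le> m" using Bound_range(1)[OF i] step.hyps by simp
  moreover have "m < d" using step.prems by simp
  ultimately have "(Normal Bot, {T (Bound v m), F (Bound v (m + 1))}) \<in> bound_encoding d c"
    using v unfolding bound_encoding_def by blast
  then have "complement (lit (F (Bound v (m + 1)))) \<in> A"
    using step F_Bot by (intro body_literal_refuted) auto
  then show ?case by simp
qed

lemma upper:
  assumes v: "v \<in> set (scope c)"
  shows "T (Atom (Bound v (upper v))) \<in> A" "upper v \<le> q v" "upper v \<le> d"
    and "T (Atom (Bound v i)) \<in> A \<Longrightarrow> upper v \<le> i"
proof -
  have q: "T (Atom (Bound v (q v))) \<in> A"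
    using v by (intro initial_in) (auto simp: initial_assignment_def)
  show "T (Atom (Bound v (upper v))) \<in> A" using q by (rule LeastI)
  show le_q: "upper v \<le> q v" using q by (rule Least_le)
  then show "upper v \<le> d" using pq v by (meson order.trans)
  show "T (Atom (Bound v i)) \<in> A \<Longrightarrow> upper v \<le> i" by (rule Least_le)
qed

lemma lower:
  assumes v: "v \<in> set (scope c)"
  shows "lower v = 0 \<or> F (Atom (Bound v (lower v))) \<in> A" "p v \<le> lower v + 1"
    and "F (Atom (Bound v i)) \<in> A \<Longrightarrow> i \<le> lower v"
proof -
  \<comment> \<open>\<open>GREATEST\<close> is attained because the set is bounded by
    \<open>d\<close> and contains 0.\<close>
  have bounded: "k \<le> d" if "k = 0 \<or> F (Atom (Bound v k)) \<in> A" for k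
    using that Bound_range(2) by fastforce
  show "lower v = 0 \<or> F (Atom (Bound v (lower v))) \<in> A"
    using GreatestI_nat[of "\<lambda>i. i = 0 \<or> F (Atom (Bound v i)) \<in> A" 0 d] bounded by blast
  show greatest: "i \<le> lower v" if "F (Atom (Bound v i)) \<in> A" for i
    using Greatest_le_nat[of "\<lambda>i. i = 0 \<or> F (Atom (Bound v i)) \<in> A" i d] bounded that by blast
  show "p v \<le> lower v + 1"
  proof (cases "p v > 1")
    case True
    then have "F (Atom (Bound v (p v - 1))) \<in> A"
      using v by (intro initial_in) (auto simp: initial_assignment_def)
    then show ?thesis using greatest by fastforce
  qed simp
qed

text \<open>Otherwise the truth of the upper bound atom would spread up to the false atom at
  \<open>lower v\<close>.\<close>

lemma lower_less_upper:
  assumes v: "v \<in> set (scope c)"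
  shows "lower v < upper v"
proof (rule ccontr)
  assume *: "\<not> lower v < upper v"
  have "1 \<le> upper v" using Bound_range(1)[OF upper(1)[OF v]] by simp
  then have F: "F (Atom (Bound v (lower v))) \<in> A" using lower(1)[OF v] * by auto
  moreover have "lower v \<le> d" using Bound_range(2)[OF F] by simp
  moreover have "upper v \<le> lower v" using * by simp
  ultimately have "T (Atom (Bound v (lower v))) \<in> A"
    using T_Bound_mono[OF v upper(1)[OF v]] by blast
  then show False using not_both[OF F] by simp
qed

text \<open>The box fixes variable \<open>i\<close> to \<open>x\<close> and spans the current
  domains of the others. Its rule would make \<open>Bound v x\<close> false at the lower end,
  against maximality of \<open>lower\<close>, or \<open>Bound v (x - 1)\<close> true at the upper
  end, against minimality of \<open>upper\<close>.\<close>

lemma no_region: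
  assumes i: "i < length (scope c)" and x: "x = lower (scope c ! i) + 1 \<or> x = upper (scope c ! i)"
  shows "\<not> conflict_region d c
      ((map lower (scope c))[i := x - 1]) ((map upper (scope c))[i := x])"
proof
  let ?v = "\<lambda>j. scope c ! j"
  let ?l = "(map lower (scope c))[i := x - 1]" and ?u = "(map upper (scope c))[i := x]"
  assume region: "conflict_region d c ?l ?u"
  have v: "?v j \<in> set (scope c)" if "j < length (scope c)" for j using that by simp
  have l: "?l ! j = (if j = i then x - 1 else lower (?v j))"
    and u: "?u ! j = (if j = i then x else upper (?v j))" if "j < length (scope c)" for j
    using that by (auto simp: nth_list_update)
  have rule: "(Normal (Violate c), region_body c ?l ?u) \<in> bound_encoding d c"
    using region by (auto simp: bound_encoding_def)
  have Violate: "F (Atom (Violate c)) \<in> A"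
    by (intro initial_in) (auto simp: initial_assignment_def)
  have lits: "lit s \<in> A" if s: "s \<in> region_body c ?l ?u"
      "s \<noteq> T (Bound (?v i) x)" "s \<noteq> F (Bound (?v i) (x - 1))" for s
  proof -
    from s(1) obtain j where j: "j < length (scope c)"
      "s = T (Bound (?v j) (?u ! j)) \<or> s = F (Bound (?v j) (?l ! j)) \<and> 0 < ?l ! j"
      unfolding region_body_def by blast
    moreover from this have "j \<noteq> i" using s(2,3) l u by auto
    ultimately have "s = T (Bound (?v j) (upper (?v j))) \<or>
        s = F (Bound (?v j) (lower (?v j))) \<and> 0 < lower (?v j)"
      using l u by simp
    then show ?thesis using upper(1)[OF v[OF j(1)]] lower(1)[OF v[OF j(1)]] by auto
  qed
  show False
  proof (cases "x = lower (?v i) + 1")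
    case True
    have "complement (lit (T (Bound (?v i) x))) \<in> A"
    proof (rule body_literal_refuted[OF rule Violate])
      show "T (Bound (?v i) x) \<in> region_body c ?l ?u"
        using region_body_T_Bound[OF i, of ?u ?l] u[OF i] by simp
    next
      fix s assume s: "s \<in> region_body c ?l ?u" "s \<noteq> T (Bound (?v i) x)"
      show "lit s \<in> A"
      proof (cases "s = F (Bound (?v i) (x - 1))")
        case F: True
        show ?thesis
        proof (cases "lower (?v i) = 0")
          case False
          then show ?thesis using F True lower(1)[OF v[OF i]] by auto
        next
          \<comment> \<open>Here \<open>x - 1 = 0\<close>, and the encoding omits this literal from
            the body.\<close>
          case zero: True
          have "0 < x - 1"
          proof -
            obtain j where "s = F (Bound (?v j) (?l ! j))" "0 < ?l ! j"
              using s(1) F unfolding region_body_def by blast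
            then show ?thesis using F by simp
          qed
          then show ?thesis using True zero by simp
        qed
      next
        case False
        then show ?thesis using lits s by blast
      qed
    qed
    then show False using lower(3)[OF v[OF i], of x] True by simp
  next
    case False
    \<comment> \<open>The domain has at least two values here, so \<open>x - 1\<close> exceeds
      \<open>lower\<close> and its literal does occur in the body.\<close>
    then have x: "x = upper (?v i)" "0 < x - 1"
      using x lower_less_upper[OF v[OF i]] by auto
    have "complement (lit (F (Bound (?v i) (x - 1)))) \<in> A"
    proof (rule body_literal_refuted[OF rule Violate])
      show "F (Bound (?v i) (x - 1)) \<in> region_body c ?l ?u"
        using region_body_F_Bound[OF i, of ?l ?u] l[OF i] x(2) by simp
    next
      fix s assume s: "s \<in> region_body c ?l ?u" "s \<noteq> F (Bound (?v i) (x - 1))"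
      show "lit s \<in> A"
      proof (cases "s = T (Bound (?v i) x)")
        case True
        then show ?thesis using x(1) upper(1)[OF v[OF i]] by simp
      next
        case False
        then show ?thesis using lits s by blast
      qed
    qed
    then show False using upper(4)[OF v[OF i], of "x - 1"] x by simp
  qed
qed

lemma fixpoint_bound_consistent: "bound_consistent c (domain_of A)"
proof -
  let ?n = "length (scope c)"
  let ?v = "\<lambda>j. scope c ! j"
  have lu: "lower (?v j) < upper (?v j)" "upper (?v j) \<le> d" if "j < ?n" for j
    using lower_less_upper[of "?v j"] upper(3)[of "?v j"] that by auto
  have dom: "domain_of A (?v j) \<noteq> {}" "Min (domain_of A (?v j)) = lower (?v j) + 1"
    "Max (domain_of A (?v j)) = upper (?v j)" if "j < ?n" for j
    using lu(1)[OF that] unfolding domain_of_def by (auto simp: Min_interval Max_interval Suc_le_eq)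
  have "\<exists>t. bound_support c (domain_of A) i x t"
    if i: "i < ?n" and x: "x = lower (?v i) + 1 \<or> x = upper (?v i)" for i x
  proof -
    let ?l = "(map lower (scope c))[i := x - 1]" and ?u = "(map upper (scope c))[i := x]"
    have l: "?l ! j = (if j = i then x - 1 else lower (?v j))"
      and u: "?u ! j = (if j = i then x else upper (?v j))" if "j < ?n" for j
      using that by (auto simp: nth_list_update)
    have pos: "0 < x" "x \<le> d" using x lu[OF i] by auto
    have "\<forall>j<?n. ?l ! j < ?u ! j \<and> ?u ! j \<le> d"
      using l u lu pos by auto
    \<comment> \<open>The box is well formed, so it fails to be a conflict region only by containing
      an allowed tuple.\<close>
    with no_region[OF i x] obtain t where t: "t \<in> allowed c" "\<forall>j<?n. ?l ! j < t ! j \<and> t ! j \<le> ?u ! j"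
      unfolding conflict_region_def by auto
    have "x - 1 < t ! i" "t ! i \<le> x" using t(2) i l u by auto
    then have "t ! i = x" by linarith
    moreover have "lower (?v j) + 1 \<le> t ! j \<and> t ! j \<le> upper (?v j)" if "j < ?n" "j \<noteq> i" for j
      using t(2) that l[OF that(1)] u[OF that(1)] by (auto simp: Suc_le_eq)
    ultimately show ?thesis
      using t(1) dom unfolding bound_support_def by auto
  qed
  then show ?thesis
    unfolding bound_consistent_def using dom by auto
qed

lemma fixpoint_bc_subdomains:
  "bc_subdomains c (\<lambda>v. {p v..q v}) (domain_of A)"
  "v \<in> set (scope c) \<Longrightarrow> domain_of A v \<noteq> {}"
proof -
  have "domain_of A w \<subseteq> {p w..q w} \<and> (\<exists>x y. domain_of A w = {x..y})" if "w \<in> set (scope c)" for w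
    using lower(2)[OF that] upper(2)[OF that] unfolding domain_of_def by auto
  then show "bc_subdomains c (\<lambda>v. {p v..q v}) (domain_of A)"
    using fixpoint_bound_consistent unfolding bc_subdomains_def by blast
  show "v \<in> set (scope c) \<Longrightarrow> domain_of A v \<noteq> {}"
    using lower_less_upper unfolding domain_of_def by (simp add: Suc_le_eq)
qed

text \<open>The larger assignment has false bound atoms only below \<open>a v\<close> and true ones
  only from \<open>b v\<close> on; \<open>1 \<le> a v\<close> covers the case
  \<open>lower v = 0\<close>.\<close>

lemma fixpoint_contains:
  assumes v: "v \<in> set (scope c)" and "A \<subseteq> domain_assignment d c a b" "1 \<le> a v"
  shows "{a v..b v} \<subseteq> domain_of A v"
proof -
  have "b v \<le> upper v"
    using upper(1)[OF v] assms(2) unfolding domain_assignment_def by auto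
  moreover have "lower v < a v"
    using lower(1)[OF v] assms(2,3) unfolding domain_assignment_def by auto
  ultimately show ?thesis unfolding domain_of_def by auto
qed

end

section \<open>Comparison of the fixpoint with the largest bound consistent subdomains\<close>

theorem theorem4:
  fixes d :: nat and c :: "'v constraint"
  assumes "is_constraint d c"
  shows "enforces_bound_consistency d c (bound_encoding d c)"
  unfolding enforces_bound_consistency_def Let_def
proof (intro allI impI)
  fix p q :: "'v \<Rightarrow> nat"
  assume pq: "\<forall>v\<in>set (scope c). 1 \<le> p v \<and> p v \<le> q v \<and> q v \<le> d"
  let ?D = "\<lambda>v. {p v..q v}"
  let ?N = "nogoods Bot (bound_encoding d c)"
  let ?A = "unit_propagation ?N (initial_assignment c p q)"
  obtain v0 where v0: "v0 \<in> set (scope c)"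
    using assms unfolding is_constraint_def by (cases "scope c") auto
  note fixpoint = fixpoint_bc_subdomains[OF assms pq refl]
  have D: "finite (?D v)" "\<exists>x y. ?D v = {x..y}" for v
    by auto
  consider (empty) "largest_bc_subdomains c ?D (\<lambda>_. {})"
    | (nonempty) a b where "largest_bc_subdomains c ?D (\<lambda>v. {a v..b v})"
      "\<And>v. v \<in> set (scope c) \<Longrightarrow> a v \<le> b v"
    by (rule largest_bc_subdomains_cases[of c ?D, OF D]) (use that in blast)+
  then show "\<exists>E. largest_bc_subdomains c ?D E \<and>
      (conflict ?N ?A \<longleftrightarrow> (\<exists>v\<in>set (scope c). E v = {})) \<and>
      (\<not> conflict ?N ?A \<longrightarrow> (\<forall>v\<in>set (scope c). domain_of ?A v = E v))"
  proof cases
    case empty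
    \<comment> \<open>A fixpoint without conflict would yield nonempty bound consistent
      subdomains.\<close>
    have "conflict ?N ?A"
    proof (rule ccontr)
      assume "\<not> conflict ?N ?A"
      then have "bc_subdomains c ?D (domain_of ?A)" "domain_of ?A v0 \<noteq> {}"
        using fixpoint v0 by blast+
      then show False using empty v0 unfolding largest_bc_subdomains_def by blast
    qed
    then show ?thesis using empty v0 by blast
  next
    case (nonempty a b)
    have sub: "bc_subdomains c ?D (\<lambda>v. {a v..b v})"
      using nonempty(1) unfolding largest_bc_subdomains_def by blast
    have ab: "p v \<le> a v" "b v \<le> q v" if "v \<in> set (scope c)" for v
      using sub that nonempty(2)[OF that] unfolding bc_subdomains_def by auto
    have bounds: "1 \<le> a v \<and> a v \<le> b v \<and> b v \<le> d" if "v \<in> set (scope c)" for v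
      using ab[OF that] pq nonempty(2)[OF that] that by fastforce
    have bc: "bound_consistent c (\<lambda>v. {a v..b v})"
      using sub unfolding bc_subdomains_def by blast
    have "initial_assignment c p q \<subseteq> domain_assignment d c a b"
      using ab pq unfolding initial_assignment_def domain_assignment_def by fastforce
    note S = unit_propagation_inert[OF consistent_domain_assignment[OF assms bounds bc]
        bound_encoding_inert[OF assms bounds bc] this]
    have "domain_of ?A v = {a v..b v}" if v: "v \<in> set (scope c)" for v
    proof
      \<comment> \<open>The fixpoint domains are themselves bound consistent, so maximality bounds
        them.\<close>
      show "domain_of ?A v \<subseteq> {a v..b v}"
        using nonempty(1) fixpoint(1)[OF S(2)] v unfolding largest_bc_subdomains_def by blast
      show "{a v..b v} \<subseteq> domain_of ?A v"
        using fixpoint_contains[OF assms pq refl S(2) v S(1)] bounds[OF v] by blast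
    qed
    then show ?thesis using nonempty S(2) by (intro exI[of _ "\<lambda>v. {a v..b v}"]) auto
  qed
qed

end
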